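(* Let $\delta\geq 1$ and let $A$ be an integer matrix with $n$ columns such that $\gcd(A_{i,1},\dots,A_{i,n})=1$ for every row index $i$, $\operatorname{rank}(A)=n$, $A$ has no singular $(n\times n)$-submatrix, and $\delta_{\max}(A)\leq\delta$. If $$n>(2C(\delta)+1)^{\log_2\delta+3}+\log_2\delta,$$ then $A$ has at most $n+1$ rows.
   Context: For a matrix $A$ with $n$ columns, $\delta_{\max}(A)$ denotes the maximum absolute value of the determinant of an $(n\times n)$-submatrix of $A$. The constant $C(\delta)$ depends only on $\delta$ and is defined as follows: let $q:=\lceil\log_2\delta\rceil$, $B_0:=\delta$, and for $i\in\{1,\dots,q\}$ $$B_i:=\delta+\sum_{l=0}^{i-1}B_l\,\delta^{\log_2\delta}(\log_2\delta)^{(\log_2\delta)/2};$$ then $C(\delta):=B_q$. *)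

theory Defs
  imports Complex_Main "Jordan_Normal_Form.DL_Rank" "Jordan_Normal_Form.DL_Submatrix"
begin

definition full_row_sets :: "'a mat \<Rightarrow> nat set set" where
  "full_row_sets A = {I. I \<subseteq> {..<dim_row A} \<and> card I = dim_col A}"

definition delta_max :: "int mat \<Rightarrow> int" where
  "delta_max A = Max ((\<lambda>I. \<bar>det (submatrix A I UNIV)\<bar>) ` full_row_sets A)"

definition has_singular_full_submatrix :: "int mat \<Rightarrow> bool" where
  "has_singular_full_submatrix A \<longleftrightarrow> (\<exists>I \<in> full_row_sets A. det (submatrix A I UNIV) = 0)"

text \<open>The empty sum at \<open>i = 0\<close> gives the initial value \<open>B_seq \<delta> 0 = \<delta>\<close>.\<close>

function B_seq :: "real \<Rightarrow> nat \<Rightarrow> real" where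
  "B_seq \<delta> i = \<delta> + (\<Sum>l\<in>{..<i}. B_seq \<delta> l * \<delta> powr log 2 \<delta> * log 2 \<delta> powr (log 2 \<delta> / 2))"
  by pat_completeness auto
termination
  by (relation "measure snd") auto

declare B_seq.simps [simp del]

text \<open>For \<open>\<delta> = 1\<close> we get \<open>C_const 1 = B_seq 1 0\<close>, so the Isabelle convention \<open>0 powr 0 = 0\<close>
  (instead of \<open>1\<close>) never affects the value of \<open>C_const\<close>.\<close>

definition C_const :: "real \<Rightarrow> real" where
  "C_const \<delta> = B_seq \<delta> (nat \<lceil>log 2 \<delta>\<rceil>)"

end

theory Submission
  imports Defs
begin

text \<open>Suppose there are at least \<open>n + 2\<close> rows, and let \<open>B\<close> consist of the first \<open>n\<close> of them, with
  two further rows \<open>a\<close> and \<open>b\<close>. For \<open>i < n\<close> let \<open>p\<^sub>i\<close> and \<open>q\<^sub>i\<close> be the determinants of \<open>B\<close> with row \<open>i\<close>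
  replaced by \<open>a\<close> and by \<open>b\<close>. These are nonzero integers of absolute value at most \<open>\<delta>\<close>. By Cramer's
  rule they are the coordinates of \<open>det B \<cdot> a\<close> and \<open>det B \<cdot> b\<close> in the rows of \<open>B\<close>, so if
  \<open>(p\<^sub>i, q\<^sub>i) = (p\<^sub>j, q\<^sub>j)\<close> with \<open>i \<noteq> j\<close>, then \<open>q\<^sub>i a - p\<^sub>i b\<close> is a combination of the rows of \<open>B\<close> other
  than \<open>i\<close> and \<open>j\<close>, and replacing rows \<open>i\<close> and \<open>j\<close> by \<open>a\<close> and \<open>b\<close> gives a singular submatrix. Hence
  the pairs are distinct and \<open>n \<le> (2\<delta> + 1)\<^sup>2\<close>. This contradicts the lower bound on \<open>n\<close>, since
  \<open>C(\<delta>) \<ge> \<delta>\<close>.\<close>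

text \<open>Rows are chosen by a function rather than a set, so exchanging a row is the update
  \<open>f(k := a)\<close> and every other row keeps its position.\<close>

definition select_rows :: "'a mat \<Rightarrow> nat \<Rightarrow> (nat \<Rightarrow> nat) \<Rightarrow> 'a mat" where
  "select_rows A n f = mat n n (\<lambda>(i, j). A $$ (f i, j))"

lemma select_rows_carrier [simp]: "select_rows A n f \<in> carrier_mat n n"
  by (simp add: select_rows_def)

text \<open>\<open>submatrix\<close> lists the chosen rows in increasing order, while
  \<open>select_rows\<close> keeps the order given by \<open>f\<close>; sorting costs only a
  sign.\<close>

lemma select_rows_eq_permuted_submatrix:
  fixes A :: "'a :: comm_ring_1 mat"
  assumes A: "A \<in> carrier_mat m n"
    and inj: "inj_on f {..<n}" and f: "f ` {..<n} \<subseteq> {..<m}"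
  shows "\<exists>p. p permutes {0..<n} \<and>
    det (select_rows A n f) = signof p * det (submatrix A (f ` {..<n}) UNIV)"
proof -
  let ?I = "f ` {..<n}"
  \<comment> \<open>The rank of \<open>f i\<close> within the image of \<open>f\<close>, hence the
    position at which \<open>submatrix\<close> places that row.\<close>
  define p where "p i = (if i < n then card {a \<in> ?I. a < f i} else i)" for i
  have cI: "card ?I = n" using inj by (simp add: card_image)
  have pick: "pick ?I (p i) = f i" if "i < n" for i
    using that pick_card_in_set[of "f i" ?I] by (simp add: p_def)
  have lt: "p i < n" if "i < n" for i
  proof -
    have "card {a \<in> ?I. a < f i} < card ?I"
      using that by (intro psubset_card_mono) auto
    then show ?thesis using that cI by (simp add: p_def)
  qed
  have "inj_on p {0..<n}"
    using pick inj by (metis (no_types, lifting) atLeastLessThan_iff inj_on_def lessThan_iff)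
  moreover have "p ` {0..<n} \<subseteq> {0..<n}" using lt by auto
  ultimately have "bij_betw p {0..<n} {0..<n}"
    by (simp add: bij_betw_def endo_inj_surj)
  then have perm: "p permutes {0..<n}"
    by (intro bij_imp_permutes) (auto simp: p_def)
  let ?S = "submatrix A ?I UNIV"
  have rows: "{i. i < dim_row A \<and> i \<in> ?I} = ?I" using f A by auto
  have S: "?S \<in> carrier_mat n n"
    using A cI by (intro carrier_matI) (simp_all only: dim_submatrix rows, auto)
  have "select_rows A n f = mat n n (\<lambda>(i, j). ?S $$ (p i, j))"
  proof (rule eq_matI)
    fix i j assume "i < dim_row (mat n n (\<lambda>(i, j). ?S $$ (p i, j)))"
      and "j < dim_col (mat n n (\<lambda>(i, j). ?S $$ (p i, j)))"
    then have i: "i < n" and j: "j < n" by auto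
    have "?S $$ (p i, j) = A $$ (pick ?I (p i), pick UNIV j)"
      using lt[OF i] j A cI by (intro submatrix_index) (simp_all only: rows, auto)
    then show "select_rows A n f $$ (i, j) = mat n n (\<lambda>(i, j). ?S $$ (p i, j)) $$ (i, j)"
      using i j by (simp add: select_rows_def pick pick_UNIV)
  qed (auto simp: select_rows_def)
  then show ?thesis using det_permute_rows[OF S perm] perm by auto
qed

lemma abs_det_select_rows:
  fixes A :: "int mat"
  assumes "A \<in> carrier_mat m n" "inj_on f {..<n}" "f ` {..<n} \<subseteq> {..<m}"
  shows "\<bar>det (select_rows A n f)\<bar> = \<bar>det (submatrix A (f ` {..<n}) UNIV)\<bar>"
proof -
  obtain p where "det (select_rows A n f) = signof p * det (submatrix A (f ` {..<n}) UNIV)"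
    using select_rows_eq_permuted_submatrix[OF assms] by blast
  then show ?thesis by (cases p rule: sign_cases) (auto simp: abs_mult)
qed

text \<open>Laplace expansion along the replaced row turns the determinants on the right into the
  entries of \<open>r\<close> times the adjugate; then adj(M) M = det(M) I. No division occurs, so
  this works over any commutative ring.\<close>

lemma cramer_rows:
  fixes M :: "'a :: comm_ring_1 mat"
  assumes M: "M \<in> carrier_mat n n" and c: "c < n"
  shows "det M * r c =
    (\<Sum>k<n. det (mat n n (\<lambda>(i, j). if i = k then r j else M $$ (i, j))) * M $$ (k, c))"
proof -
  let ?R = "\<lambda>k. mat n n (\<lambda>(i, j). if i = k then r j else M $$ (i, j))"
  have expand: "det (?R k) = (\<Sum>j<n. r j * adj_mat M $$ (j, k))" if k: "k < n" for k
  proof -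
    \<comment> \<open>The only altered row is the one deleted, so cofactors along row
      \<open>k\<close> are those of \<open>M\<close>.\<close>
    have "mat_delete (?R k) k j = mat_delete M k j" if "j < n" for j
      using M k that by (intro eq_matI) (auto simp: mat_delete_def)
    then have "cofactor (?R k) k j = adj_mat M $$ (j, k)" if "j < n" for j
      using M k that by (simp add: cofactor_def adj_mat_def)
    then show ?thesis
      using laplace_expansion_row[of "?R k" n k] k by simp
  qed
  have adj: "(\<Sum>k<n. adj_mat M $$ (j, k) * M $$ (k, c)) = (if j = c then det M else 0)"
    if j: "j < n" for j
  proof -
    have "(\<Sum>k<n. adj_mat M $$ (j, k) * M $$ (k, c)) = (adj_mat M * M) $$ (j, c)"
      using M adj_mat(1)[OF M] j c by (simp add: scalar_prod_def atLeast0LessThan)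
    then show ?thesis using adj_mat(3)[OF M] j c by simp
  qed
  have "(\<Sum>k<n. det (?R k) * M $$ (k, c)) =
      (\<Sum>k<n. \<Sum>j<n. r j * (adj_mat M $$ (j, k) * M $$ (k, c)))"
    by (simp add: expand sum_distrib_right mult.assoc)
  also have "\<dots> = (\<Sum>j<n. r j * (\<Sum>k<n. adj_mat M $$ (j, k) * M $$ (k, c)))"
    by (subst sum.swap) (simp add: sum_distrib_left)
  also have "\<dots> = (\<Sum>j<n. if j = c then r j * det M else 0)"
    by (intro sum.cong) (auto simp: adj)
  also have "\<dots> = det M * r c" using c by (simp add: mult.commute)
  finally show ?thesis by simp
qed

lemma cramer_select_rows:
  fixes A :: "'a :: comm_ring_1 mat"
  assumes c: "c < n"
  shows "det (select_rows A n f) * A $$ (a, c) =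
    (\<Sum>k<n. det (select_rows A n (f(k := a))) * A $$ (f k, c))"
proof -
  have "mat n n (\<lambda>(i, j). if i = k then A $$ (a, j) else select_rows A n f $$ (i, j)) =
      select_rows A n (f(k := a))" for k
    by (intro eq_matI) (auto simp: select_rows_def)
  then show ?thesis
    using cramer_rows[OF select_rows_carrier[of A n f] c, of "\<lambda>j. A $$ (a, j)"] c
    by (simp add: select_rows_def)
qed

text \<open>The weights form a nonzero vector in the kernel of the transpose.\<close>

lemma det_zero_if_rows_dependent:
  fixes M :: "'a :: idom mat"
  assumes M: "M \<in> carrier_mat n n"
    and dep: "\<And>c. c < n \<Longrightarrow> (\<Sum>k<n. w k * M $$ (k, c)) = 0"
    and nz: "i < n" "w i \<noteq> 0"
  shows "det M = 0"
proof -
  have "M\<^sup>T *\<^sub>v vec n w = 0\<^sub>v n"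
    using M dep by (intro eq_vecI) (auto simp: scalar_prod_def atLeast0LessThan mult.commute)
  moreover have "vec n w \<noteq> 0\<^sub>v n" using nz by (metis index_vec index_zero_vec(1))
  ultimately have "det M\<^sup>T = 0"
    unfolding det_0_iff_vec_prod_zero[OF iffD2[OF transpose_carrier_mat M]]
    by (intro exI[of _ "vec n w"]) simp
  then show ?thesis using det_transpose[OF M] by simp
qed

lemma det_exchange_two_rows_zero:
  fixes A :: "'a :: idom mat" and f :: "nat \<Rightarrow> nat" and n :: nat
  defines "D \<equiv> \<lambda>g. det (select_rows A n g)"
  assumes ij: "i < n" "j < n" "i \<noteq> j"
    and eq: "D (f(i := a)) = D (f(j := a))" "D (f(i := b)) = D (f(j := b))"
    and nz: "D f \<noteq> 0" "D (f(i := b)) \<noteq> 0"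
  shows "D (f(i := a, j := b)) = 0"
proof -
  define p where "p k = D (f(k := a))" for k
  define q where "q k = D (f(k := b))" for k
  \<comment> \<open>Cramer's rule expands \<open>D f\<close> times \<open>q i\<close> a -
    \<open>p i\<close> b in the rows of \<open>f\<close> with coefficients
    \<open>q i * p k - p i * q k\<close>. Moving this expansion to the other side gives the
    weights.\<close>
  define w where "w k = (if k = i then q i * D f else if k = j then - (p i * D f)
    else p i * q k - q i * p k)" for k
  let ?f = "f(i := a, j := b)"
  let ?K = "{..<n} - {i} - {j}"
  have split: "(\<Sum>k<n. h k) = h i + (h j + sum h ?K)" for h :: "nat \<Rightarrow> 'a"
    using ij by (simp add: sum.remove[of "{..<n}" i] sum.remove[of "{..<n} - {i}" j])
  have "(\<Sum>k<n. w k * select_rows A n ?f $$ (k, c)) = 0" if c: "c < n" for c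
  proof -
    have a: "D f * A $$ (a, c) = (\<Sum>k<n. p k * A $$ (f k, c))"
      and b: "D f * A $$ (b, c) = (\<Sum>k<n. q k * A $$ (f k, c))"
      unfolding D_def p_def q_def by (rule cramer_select_rows[OF c])+
    have "(\<Sum>k<n. w k * select_rows A n ?f $$ (k, c)) = (\<Sum>k<n. w k * A $$ (?f k, c))"
      using c by (simp add: select_rows_def)
    also have "\<dots> = w i * A $$ (a, c) + (w j * A $$ (b, c) + (\<Sum>k\<in>?K. w k * A $$ (?f k, c)))"
      using ij split[of "\<lambda>k. w k * A $$ (?f k, c)"] by simp
    also have "(\<Sum>k\<in>?K. w k * A $$ (?f k, c)) =
        (\<Sum>k\<in>?K. (p i * q k - q i * p k) * A $$ (f k, c))"
      by (intro sum.cong) (auto simp: w_def)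
    \<comment> \<open>The added terms vanish: trivially at \<open>i\<close>, and at \<open>j\<close>
      because \<open>p\<close> and \<open>q\<close> agree at \<open>i\<close> and
      \<open>j\<close>.\<close>
    also have "\<dots> = (\<Sum>k<n. (p i * q k - q i * p k) * A $$ (f k, c))"
      using eq split[of "\<lambda>k. (p i * q k - q i * p k) * A $$ (f k, c)"]
      by (simp add: p_def q_def)
    also have "\<dots> = p i * (\<Sum>k<n. q k * A $$ (f k, c)) - q i * (\<Sum>k<n. p k * A $$ (f k, c))"
      by (simp add: sum_distrib_left sum_subtractf left_diff_distrib mult.assoc)
    also have "\<dots> = p i * (D f * A $$ (b, c)) - q i * (D f * A $$ (a, c))"
      by (simp only: a b)
    also have "w i * A $$ (a, c) + (w j * A $$ (b, c) +
        (p i * (D f * A $$ (b, c)) - q i * (D f * A $$ (a, c)))) = 0"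
      using ij by (simp add: w_def algebra_simps)
    finally show ?thesis .
  qed
  moreover have "w i \<noteq> 0" using nz by (simp add: w_def q_def)
  ultimately show ?thesis
    unfolding D_def using ij by (intro det_zero_if_rows_dependent[of _ n w i]) auto
qed

lemma abs_det_le_delta_max:
  assumes "I \<in> full_row_sets A"
  shows "\<bar>det (submatrix A I UNIV)\<bar> \<le> delta_max A"
proof -
  have "finite (full_row_sets A)" by (simp add: full_row_sets_def)
  then show ?thesis using assms by (simp add: delta_max_def)
qed

text \<open>Pigeonhole: with \<open>id\<close> as the base selection and rows \<open>n\<close> and
  \<open>Suc n\<close> as the extra ones, the pairs \<open>P i\<close> are distinct points of an
  integer square.\<close>

lemma num_cols_le_of_two_extra_rows:
  fixes A :: "int mat"
  assumes A: "A \<in> carrier_mat m n" and m: "n + 2 \<le> m"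
    and nonsing: "\<not> has_singular_full_submatrix A"
  shows "int n \<le> (2 * delta_max A + 1)\<^sup>2"
proof -
  define D where "D g = det (select_rows A n g)" for g
  have D: "D g \<noteq> 0" "\<bar>D g\<bar> \<le> delta_max A"
    if "inj_on g {..<n}" "g ` {..<n} \<subseteq> {..<m}" for g
  proof -
    have I: "g ` {..<n} \<in> full_row_sets A"
      using that A by (simp add: full_row_sets_def card_image)
    show "\<bar>D g\<bar> \<le> delta_max A"
      unfolding D_def abs_det_select_rows[OF A that] by (rule abs_det_le_delta_max[OF I])
    show "D g \<noteq> 0"
      using nonsing I abs_det_select_rows[OF A that]
      by (auto simp: has_singular_full_submatrix_def D_def)
  qed
  define P where "P i = (D (id(i := n)), D (id(i := Suc n)))" for i
  let ?J = "{- delta_max A..delta_max A}"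
  have one: "D (id(i := r)) \<noteq> 0" "D (id(i := r)) \<in> ?J" if "n \<le> r" "r < m" for i r
  proof -
    have "inj_on (id(i := r)) {..<n}" "(id(i := r)) ` {..<n} \<subseteq> {..<m}"
      using that by (auto simp: inj_on_def)
    from D[OF this] show "D (id(i := r)) \<noteq> 0" "D (id(i := r)) \<in> ?J" by auto
  qed
  have id: "D id \<noteq> 0" using D(1)[of id] m by auto
  have "inj_on P {..<n}"
  proof (rule inj_onI, rule ccontr)
    fix i j assume ij: "i \<in> {..<n}" "j \<in> {..<n}" "P i = P j" "i \<noteq> j"
    then have "D (id(i := n, j := Suc n)) = 0"
      using one[of "Suc n" i] id m unfolding P_def D_def
      by (intro det_exchange_two_rows_zero) auto
    moreover have "D (id(i := n, j := Suc n)) \<noteq> 0"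
      using ij m by (intro D(1)) (auto simp: inj_on_def)
    ultimately show False by contradiction
  qed
  moreover have "P ` {..<n} \<subseteq> ?J \<times> ?J"
    using one(2)[of n] one(2)[of "Suc n"] m by (auto simp: P_def)
  ultimately have "card {..<n} \<le> card (?J \<times> ?J)" by (intro card_inj_on_le) auto
  then have "n \<le> (nat (2 * delta_max A + 1))\<^sup>2"
    by (simp add: power2_eq_square)
  \<comment> \<open>Nonnegativity ensures that \<open>nat\<close> does not truncate the side length
    of the square.\<close>
  moreover have "0 \<le> delta_max A" using D(2)[of id] m by fastforce
  ultimately show ?thesis
    by (metis add_nonneg_nonneg int_nat_eq mult_nonneg_nonneg of_nat_le_iff of_nat_power
        zero_le_numeral zero_le_one)
qed

text \<open>All summands of the recursion are nonnegative by strong induction. This is the only fact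
  about the growth of \<open>C_const\<close> that enters.\<close>

lemma B_seq_ge:
  assumes "0 \<le> \<delta>"
  shows "\<delta> \<le> B_seq \<delta> i"
proof (induction i rule: less_induct)
  case (less i)
  have "0 \<le> (\<Sum>l<i. B_seq \<delta> l * \<delta> powr log 2 \<delta> * log 2 \<delta> powr (log 2 \<delta> / 2))"
    using less assms by (intro sum_nonneg mult_nonneg_nonneg) (auto intro: order_trans)
  then show ?case by (subst B_seq.simps) simp
qed

theorem lemma7:
  fixes A :: "int mat" and m n :: nat and \<delta> :: real
  assumes "\<delta> \<ge> 1"
    and "A \<in> carrier_mat m n"
    and "\<And>i. i < m \<Longrightarrow> Gcd {A $$ (i, j) | j. j < n} = 1"
    and "vec_space.rank m (map_mat real_of_int A) = n"
    and "\<not> has_singular_full_submatrix A"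
    and "real_of_int (delta_max A) \<le> \<delta>"
    and "real n > (2 * C_const \<delta> + 1) powr (log 2 \<delta> + 3) + log 2 \<delta>"
  shows "m \<le> n + 1"
proof (rule ccontr)
  assume "\<not> m \<le> n + 1"
  then have m: "n + 2 \<le> m" by simp
  let ?C = "C_const \<delta>"
  have C: "\<delta> \<le> ?C" using assms(1) by (simp add: C_const_def B_seq_ge)
  have log: "0 \<le> log 2 \<delta>" using assms(1) by simp
  \<comment> \<open>A concrete row set bounds \<open>delta_max A\<close> below by an absolute value,
    so squaring is monotone.\<close>
  have "{..<n} \<in> full_row_sets A" using assms(2) m by (auto simp: full_row_sets_def)
  then have "0 \<le> delta_max A" using abs_det_le_delta_max abs_ge_zero order_trans by blast
  then have "(2 * real_of_int (delta_max A) + 1)\<^sup>2 \<le> (2 * ?C + 1)\<^sup>2"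
    using assms(6) C by (intro power_mono) auto
  moreover have "real n \<le> (2 * real_of_int (delta_max A) + 1)\<^sup>2"
    using num_cols_le_of_two_extra_rows[OF assms(2) m assms(5)]
    by (metis (mono_tags, lifting) of_int_1 of_int_add of_int_le_iff of_int_mult
        of_int_numeral of_int_of_nat_eq of_int_power)
  moreover have "(2 * ?C + 1)\<^sup>2 = (2 * ?C + 1) powr 2"
    using assms(1) C by (simp add: powr_numeral)
  \<comment> \<open>The base is at least 1 and the exponent on the right is at least 3.\<close>
  moreover have "(2 * ?C + 1) powr 2 \<le> (2 * ?C + 1) powr (log 2 \<delta> + 3)"
    using assms(1) C log by (intro powr_mono) auto
  ultimately show False using assms(7) log by linarith
qed

end
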